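(* Let $G$ be a graph with at least one edge. For every integer $r\ge 2$, $$\lambda(G)^r \le \sum_{uv\in E(G)} \frac{c_G(uv)-1}{c_G(uv)}\bigl(w_{r-1}(u)+w_{r-1}(v)\bigr).$$ Moreover, equality holds if and only if, after deleting all isolated vertices of $G$, the remaining graph is either a regular complete $\omega(G)$-partite graph with $\omega(G)\ge 3$, or a complete bipartite graph when $\omega(G)=2$, where in the latter case, if $r$ is odd, the remaining complete bipartite graph is additionally required to be regular.
   Context: All graphs are finite and simple. For a graph $G$, $\lambda(G)$ denotes the largest eigenvalue of its adjacency matrix $A(G)$, and $\omega(G)$ denotes its clique number. For an edge $uv\in E(G)$, $c_G(uv)$ is the maximum order (number of vertices) of a clique in $G$ containing both $u$ and $v$. For a vertex $v$ and an integer $r\ge 1$, $w_r(v)$ is the number of walks on $r$ vertices (vertices may repeat; consecutive vertices adjacent) starting at $v$; equivalently $w_r(v)=(A(G)^{r-1}\mathbf{1})_v$, where $\mathbf 1$ is the all-one vector (so $w_1(v)=1$). The sum over $uv\in E(G)$ counts each (unordered) edge once. *)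

theory Defs
  imports "HOL-Analysis.Analysis" "HOL-Library.Ramsey" "HOL-Library.Disjoint_Sets"
begin

text \<open>
  A graph is given by a vertex set \<open>V\<close> and a set \<open>E\<close> of two-element subsets of \<open>V\<close>;
  cliques are those of \<open>HOL-Library.Ramsey\<close>. Where matrices are involved, \<open>V\<close> is all of a
  finite type, which indexes rows and columns.
\<close>

definition simple_graph :: "'a set \<Rightarrow> 'a set set \<Rightarrow> bool" where
  "simple_graph V E \<longleftrightarrow> finite V \<and> E \<subseteq> nsets V 2"

definition adjacency_matrix :: "'n::finite set set \<Rightarrow> real ^ 'n ^ 'n" where
  "adjacency_matrix E = (\<chi> u v. if {u, v} \<in> E then 1 else 0)"

definition eigenvalues :: "real ^ 'n ^ 'n \<Rightarrow> real set" where
  "eigenvalues A = {c. \<exists>x. x \<noteq> 0 \<and> A *v x = c *\<^sub>R x}"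

text \<open>
  The maximum exists: the adjacency matrix is a real symmetric matrix of positive size, so its
  set of real eigenvalues is finite and nonempty.
\<close>

definition graph_index :: "'n::finite set set \<Rightarrow> real" where
  "graph_index E = Max (eigenvalues (adjacency_matrix E))"

definition clique_number :: "'a set \<Rightarrow> 'a set set \<Rightarrow> nat" where
  "clique_number V E = Max (card ` {K. K \<subseteq> V \<and> clique K E})"

definition edge_clique_number :: "'a set \<Rightarrow> 'a set set \<Rightarrow> 'a set \<Rightarrow> nat" where
  "edge_clique_number V E e = Max (card ` {K. K \<subseteq> V \<and> clique K E \<and> e \<subseteq> K})"

text \<open>
  The parameter \<open>r\<close> counts vertices of the walk, not edges. It is meant for \<open>r \<ge> 1\<close>.
\<close>

definition walks_from :: "'a set set \<Rightarrow> nat \<Rightarrow> 'a \<Rightarrow> 'a list set" where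
  "walks_from E r v = {p. length p = r \<and> hd p = v \<and> successively (\<lambda>x y. {x, y} \<in> E) p}"

definition num_walks :: "'a set set \<Rightarrow> nat \<Rightarrow> 'a \<Rightarrow> nat" where
  "num_walks E r v = card (walks_from E r v)"

definition degree :: "'a set set \<Rightarrow> 'a \<Rightarrow> nat" where
  "degree E v = card {e \<in> E. v \<in> e}"

definition regular_graph :: "'a set \<Rightarrow> 'a set set \<Rightarrow> bool" where
  "regular_graph V E \<longleftrightarrow> (\<exists>d. \<forall>v\<in>V. degree E v = d)"

text \<open>
  The \<open>k\<close> parts are nonempty, as \<open>partition_on\<close> excludes the empty set.
\<close>

definition complete_partite :: "nat \<Rightarrow> 'a set \<Rightarrow> 'a set set \<Rightarrow> bool" where
  "complete_partite k V E \<longleftrightarrow>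
     (\<exists>P. partition_on V P \<and> card P = k \<and>
          E = {{u, v} | u v. \<exists>A\<in>P. \<exists>B\<in>P. A \<noteq> B \<and> u \<in> A \<and> v \<in> B})"

definition isolated_vertices :: "'a set \<Rightarrow> 'a set set \<Rightarrow> 'a set" where
  "isolated_vertices V E = {v \<in> V. degree E v = 0}"

end

theory Submission
  imports Defs
begin

text \<open>
  Write \<open>A\<close> for the adjacency matrix, \<open>\<lambda>\<close> for its largest eigenvalue, \<open>n = r - 2\<close>, and \<open>m u v = (c - 1) / c\<close>
  on an edge \<open>uv\<close> with local clique number \<open>c\<close>. Let \<open>x\<close> be a nonnegative unit eigenvector for \<open>\<lambda>\<close>. Since the
  walk numbers are the row sums of the powers of \<open>A\<close>, the right-hand side is
  \<open>S = (\<Sum>u v z. A u v * m u v * (A^n) v z)\<close>, a weighted count of walks with first edge \<open>uv\<close> and last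
  vertex \<open>z\<close>.

  The inequality compares the uniform weight on walks with the walk distribution
  \<open>q u v z = A u v * (A^n) v z * x u * x z / \<lambda>^(n+1)\<close>: by \<open>ln t \<le> t - 1\<close>,
  \<open>S / \<lambda>^(n+2) - 1\<close> is at least the \<open>q\<close>-average of \<open>ln (m u v / (\<lambda> * x u * x z))\<close>. Both \<open>v\<close> and \<open>z\<close> have
  the distribution \<open>x^2\<close> under \<open>q\<close>, so \<open>x z\<close> may be replaced by \<open>x v\<close> inside the average of the logarithm, and a
  second use of \<open>ln t \<le> t - 1\<close> turns the bound into \<open>S \<ge> \<lambda>^(n+2) * (2 - F)\<close> with
  \<open>F = (\<Sum>u v. A u v / m u v * (x u)^2 * (x v)^2)\<close> (\<open>tilted_entropy_bound\<close>). The localized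
  Motzkin--Straus inequality says \<open>F \<le> 1\<close> because \<open>x^2\<close> is a probability vector
  (\<open>localized_Motzkin_Straus\<close>), and the bound \<open>\<lambda>^r \<le> S\<close> follows.

  If equality holds, every logarithmic estimate is sharp, so that \<open>x\<close> is positive at all edges,
  \<open>\<lambda> * x u * x v = m u v\<close> on edges, and \<open>x v = x z\<close> whenever a walk with \<open>n\<close> edges joins \<open>v\<close> to \<open>z\<close>; for odd
  \<open>n\<close> this applies to the two ends of an edge. Moreover \<open>F = 1\<close>, and a maximizer of the Motzkin--Straus form
  can only be perturbed without gain if nonadjacency is transitive on its support
  (\<open>nonadjacency_transitive_if_extremal\<close>). Hence the nonisolated vertices span a complete \<open>k\<close>-partite graph,
  all local clique numbers equal \<open>k = \<omega>\<close>, and \<open>m\<close> is constant. For \<open>k \<ge> 3\<close> every edge lies in a triangle, and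
  \<open>\<lambda> * x u * x w = \<lambda> * x v * x w\<close> there gives \<open>x u = x v\<close>; an eigenvector that is constant along edges forces
  all degrees to be \<open>\<lambda>\<close>. Conversely, for the listed graphs \<open>S\<close> evaluates to \<open>c^r\<close> for an explicit eigenvalue
  \<open>c \<le> \<lambda>\<close>, and the inequality itself supplies the reverse estimate.
\<close>

section \<open>Edges of simple graphs\<close>

lemma simple_graph_edgeD:
  assumes "simple_graph V E" "{u, v} \<in> E"
  shows "u \<in> V" "v \<in> V" "u \<noteq> v"
proof -
  have "{u, v} \<in> nsets V 2" using assms unfolding simple_graph_def by blast
  then show "u \<in> V" "v \<in> V" "u \<noteq> v" by simp_all
qed

lemma simple_graph_edgeE:
  assumes "simple_graph V E" "e \<in> E"
  obtains u v where "e = {u, v}" "u \<noteq> v"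
proof -
  have "card e = 2" using assms by (auto simp: simple_graph_def nsets_def)
  then show thesis using that by (auto simp: card_2_iff)
qed

section \<open>The localized Motzkin--Straus inequality\<close>

definition quad_form :: "'a set \<Rightarrow> ('a \<Rightarrow> 'a \<Rightarrow> real) \<Rightarrow> ('a \<Rightarrow> real) \<Rightarrow> real" where
  "quad_form V q p = (\<Sum>u\<in>V. \<Sum>v\<in>V. q u v * p u * p v)"

definition point_mass :: "'a \<Rightarrow> 'a \<Rightarrow> real" where
  "point_mass u x = of_bool (x = u)"


lemma quad_form_perturb:
  assumes sym: "\<And>u v. q u v = q v u"
  shows "quad_form V q (\<lambda>x. p x + d x) =
    quad_form V q p + 2 * (\<Sum>x\<in>V. d x * (\<Sum>y\<in>V. q x y * p y)) + quad_form V q d"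
proof -
  have "(\<Sum>u\<in>V. \<Sum>v\<in>V. q u v * p u * d v) = (\<Sum>x\<in>V. d x * (\<Sum>y\<in>V. q x y * p y))"
    by (subst sum.swap) (simp add: sym sum_distrib_left mult_ac)
  moreover have "(\<Sum>u\<in>V. \<Sum>v\<in>V. q u v * d u * p v) = (\<Sum>x\<in>V. d x * (\<Sum>y\<in>V. q x y * p y))"
    by (simp add: sum_distrib_left mult_ac)
  ultimately show ?thesis
    unfolding quad_form_def by (simp add: algebra_simps sum.distrib)
qed

lemma sum_point_mass:
  assumes "finite V" "u \<in> V"
  shows "(\<Sum>x\<in>V. point_mass u x * f x) = f u"
  using assms by (simp add: point_mass_def of_bool_def if_distrib[of "\<lambda>a. a * _"] cong: if_cong)

text \<open>
  The perturbation adds \<open>t\<close> at \<open>u\<close> and at \<open>w\<close> and takes \<open>2 * t\<close> from \<open>v\<close>. As \<open>v\<close> is orthogonal to both \<open>u\<close> and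
  \<open>w\<close> and the diagonal vanishes, the only quadratic term left is the one of the pair \<open>u\<close>, \<open>w\<close>. For
  \<open>u = w\<close> this too disappears: moving mass between two nonadjacent vertices changes the form linearly.
\<close>

lemma quad_form_shift:
  fixes p :: "'a \<Rightarrow> real" and t :: real
  assumes fin: "finite V" and V: "u \<in> V" "v \<in> V" "w \<in> V"
    and sym: "\<And>u v. q u v = q v u" and diag: "\<And>u. q u u = 0" and "q u v = 0" "q v w = 0"
  defines "d \<equiv> \<lambda>x. t * (point_mass u x + point_mass w x - 2 * point_mass v x)"
    and "g \<equiv> \<lambda>x. \<Sum>y\<in>V. q x y * p y"
  shows "quad_form V q (\<lambda>x. p x + d x) =
    quad_form V q p + 2 * t * (g u + g w - 2 * g v) + 2 * t^2 * q u w"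
proof -
  have d: "(\<Sum>x\<in>V. d x * f x) = t * (f u + f w - 2 * f v)" for f
  proof -
    have "(\<Sum>x\<in>V. d x * f x) = t * ((\<Sum>x\<in>V. point_mass u x * f x) + (\<Sum>x\<in>V. point_mass w x * f x)
         - 2 * (\<Sum>x\<in>V. point_mass v x * f x))"
      by (simp add: d_def algebra_simps sum.distrib sum_subtractf sum_distrib_left)
    then show ?thesis using fin V by (simp add: sum_point_mass)
  qed
  have "quad_form V q d = (\<Sum>x\<in>V. d x * (\<Sum>y\<in>V. d y * q x y))"
    by (simp add: quad_form_def sum_distrib_left mult_ac)
  also have "\<dots> = 2 * t^2 * q u w"
    using assms(5-8) sym[of v u] sym[of w v] sym[of w u]
    unfolding d by (simp add: power2_eq_square algebra_simps)
  finally show ?thesis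
    using d[of g] by (simp add: quad_form_perturb[OF sym] g_def)
qed

lemma clique_card_le_edge_clique_number:
  assumes "finite V" "K \<subseteq> V" "clique K E" "e \<subseteq> K"
  shows "card K \<le> edge_clique_number V E e"
  unfolding edge_clique_number_def using assms by (intro Max_ge) auto

lemma edge_clique_number_ge_2:
  assumes "simple_graph V E" "{u, v} \<in> E"
  shows "2 \<le> edge_clique_number V E {u, v}"
proof -
  have "card {u, v} \<le> edge_clique_number V E {u, v}"
    using assms simple_graph_edgeD[OF assms]
    by (intro clique_card_le_edge_clique_number) (auto simp: simple_graph_def clique_def insert_commute)
  then show ?thesis using simple_graph_edgeD[OF assms] by simp
qed

text \<open>
  Non-edges get weight \<open>0\<close>, so that sums may run over all ordered pairs of vertices.
\<close>

definition clique_weight :: "'a set \<Rightarrow> 'a set set \<Rightarrow> 'a \<Rightarrow> 'a \<Rightarrow> real" where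
  "clique_weight V E u v = (if {u, v} \<in> E
     then real (edge_clique_number V E {u, v}) / (real (edge_clique_number V E {u, v}) - 1) else 0)"

lemma clique_weight_commute: "clique_weight V E u v = clique_weight V E v u"
  by (simp add: clique_weight_def insert_commute)

lemma clique_weight_diag: "simple_graph V E \<Longrightarrow> clique_weight V E u u = 0"
  using simple_graph_edgeD(3)[of V E u u] by (auto simp: clique_weight_def)

lemma clique_weight_pos:
  "simple_graph V E \<Longrightarrow> {u, v} \<in> E \<Longrightarrow> 0 < clique_weight V E u v"
  using edge_clique_number_ge_2[of V E u v] by (simp add: clique_weight_def)

text \<open>
  \<open>t / (t - 1)\<close> is decreasing, and the local clique number of an edge inside a clique is at least the size of
  that clique.
\<close>

lemma clique_weight_le:
  assumes "finite V" "K \<subseteq> V" "clique K E" "u \<in> K" "v \<in> K" "u \<noteq> v"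
  shows "clique_weight V E u v \<le> real (card K) / (real (card K) - 1)"
proof -
  have e: "{u, v} \<in> E" using assms by (auto simp: clique_def)
  have "finite K" using assms finite_subset by blast
  then have k: "2 \<le> card K"
    using assms card_mono[of K "{u, v}"] by auto
  have "card K \<le> edge_clique_number V E {u, v}"
    using assms by (intro clique_card_le_edge_clique_number) auto
  then have "real (card K) \<le> real (edge_clique_number V E {u, v})" by simp
  with k show ?thesis using e by (simp add: clique_weight_def field_simps)
qed

text \<open>
  On a clique with \<open>k\<close> vertices all weights are at most \<open>k / (k - 1)\<close>, and the sum of \<open>p u * p v\<close> over
  ordered pairs of distinct vertices is \<open>1 - (\<Sum>u. (p u)^2) \<le> 1 - 1 / k\<close> by Cauchy--Schwarz. For \<open>k = 1\<close>
  the factor \<open>k / (k - 1)\<close> is the default value \<open>0\<close>, which is then the correct bound.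
\<close>

lemma quad_form_clique_le_1:
  assumes G: "simple_graph V E" and K: "K \<subseteq> V" "clique K E"
    and p: "\<And>v. v \<in> V \<Longrightarrow> 0 \<le> p v" "\<And>v. v \<in> V - K \<Longrightarrow> p v = 0" "sum p V = 1"
  shows "quad_form V (clique_weight V E) p \<le> 1"
proof -
  define k where "k = real (card K)"
  have fin: "finite V" "finite K" using G K finite_subset by (auto simp: simple_graph_def)
  have pK: "sum p K = 1" using sum.mono_neutral_right[OF fin(1) K(1), of p] p by auto
  have "K \<noteq> {}" using pK by auto
  then have k1: "1 \<le> k" using fin(2) by (simp add: k_def Suc_le_eq card_gt_0_iff)
  have "quad_form V (clique_weight V E) p = (\<Sum>u\<in>K. \<Sum>v\<in>K. clique_weight V E u v * p u * p v)"
    unfolding quad_form_def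
    by (subst (1 2) sum.mono_neutral_right[OF fin(1) K(1)]) (use p in auto)
  also have "\<dots> \<le> (\<Sum>u\<in>K. \<Sum>v\<in>K. k / (k - 1) * (p u * p v - of_bool (u = v) * (p u)\<^sup>2))"
  proof (intro sum_mono)
    fix u v assume uv: "u \<in> K" "v \<in> K"
    then have "0 \<le> p u * p v" using p(1)[of u] p(1)[of v] K by (auto intro: mult_nonneg_nonneg)
    then show "clique_weight V E u v * p u * p v \<le> k / (k - 1) * (p u * p v - of_bool (u = v) * (p u)\<^sup>2)"
      using clique_weight_le[OF fin(1) K uv] clique_weight_diag[OF G]
      by (cases "u = v") (auto simp: k_def power2_eq_square mult.assoc simp del: times_divide_eq_left
          intro: mult_right_mono)
  qed
  also have "\<dots> = k / (k - 1) * (\<Sum>u\<in>K. \<Sum>v\<in>K. p u * p v - of_bool (u = v) * (p u)\<^sup>2)"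
    by (simp only: sum_distrib_left)
  also have "(\<Sum>u\<in>K. \<Sum>v\<in>K. p u * p v - of_bool (u = v) * (p u)\<^sup>2)
      = (sum p K)\<^sup>2 - (\<Sum>u\<in>K. (p u)\<^sup>2)"
    using fin by (simp add: sum_subtractf power2_eq_square sum_product of_bool_def
        if_distrib[of "\<lambda>a. a * _"] cong: if_cong)
  also have "k / (k - 1) * ((sum p K)\<^sup>2 - (\<Sum>u\<in>K. (p u)\<^sup>2)) \<le> k / (k - 1) * (1 - 1 / k)"
  proof (rule mult_left_mono)
    have "(sum p K)\<^sup>2 \<le> k * (\<Sum>u\<in>K. (p u)\<^sup>2)"
      unfolding k_def using sum_squared_le_sum_of_squares[of p K] fin by (simp add: mult.commute)
    then show "(sum p K)\<^sup>2 - (\<Sum>u\<in>K. (p u)\<^sup>2) \<le> 1 - 1 / k"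
      using k1 pK by (simp add: field_simps)
  qed (use k1 in simp)
  also have "\<dots> \<le> 1" using k1 by (simp add: field_simps)
  finally show ?thesis .
qed

text \<open>
  As long as the support contains two nonadjacent vertices, the form is linear along the exchange of mass between
  them, so one of the two can be emptied without decreasing the form. This shrinks the support until it is a
  clique, where the bound is elementary.
\<close>

lemma localized_Motzkin_Straus:
  assumes G: "simple_graph V E"
    and p: "\<And>v. v \<in> V \<Longrightarrow> 0 \<le> p v" "sum p V = 1"
  shows "quad_form V (clique_weight V E) p \<le> 1"
  using p
proof (induction "card {v \<in> V. p v \<noteq> 0}" arbitrary: p rule: less_induct)
  case less
  let ?q = "clique_weight V E" and ?K = "{v \<in> V. p v \<noteq> 0}"
  have fin: "finite V" using G by (simp add: simple_graph_def)
  show ?case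
  proof (cases "clique ?K E")
    case True
    then show ?thesis using less.prems by (intro quad_form_clique_le_1[OF G, of ?K]) auto
  next
    case False
    define g where "g = (\<lambda>x. \<Sum>y\<in>V. ?q x y * p y)"
    obtain u v where uv: "u \<in> ?K" "v \<in> ?K" "u \<noteq> v" "{u, v} \<notin> E" "g v \<le> g u"
    proof -
      obtain a b where "a \<in> ?K" "b \<in> ?K" "a \<noteq> b" "{a, b} \<notin> E"
        using False by (auto simp: clique_def)
      then show thesis using that[of a b] that[of b a] by (cases "g b \<le> g a") (auto simp: insert_commute)
    qed
    \<comment> \<open>The whole mass of \<open>v\<close> moves to \<open>u\<close>. The shift takes \<open>2 * t\<close> from \<open>v\<close>, hence \<open>t = p v / 2\<close>.\<close>
    define p' where "p' = (\<lambda>x. p x + p v / 2 * (point_mass u x + point_mass u x - 2 * point_mass v x))"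
    have p': "p' = p(u := p u + p v, v := 0)"
      using uv by (auto simp: p'_def point_mass_def fun_eq_iff)
    have q0: "?q u v = 0" "?q v u = 0" using uv by (simp_all add: clique_weight_def insert_commute)
    have "quad_form V ?q p' = quad_form V ?q p + 2 * p v * (g u - g v)"
      using quad_form_shift[where q = "clique_weight V E" and p = p and t = "p v / 2",
          OF fin _ _ _ clique_weight_commute clique_weight_diag[OF G] q0] uv
      unfolding p'_def g_def by (simp add: clique_weight_diag[OF G] right_diff_distrib)
    moreover have "0 \<le> 2 * p v * (g u - g v)" using uv less.prems(1) by auto
    moreover have "quad_form V ?q p' \<le> 1"
    proof (rule less.hyps)
      have "{v \<in> V. p' v \<noteq> 0} \<subset> ?K" using uv less.prems(1) by (auto simp: p')
      then show "card {v \<in> V. p' v \<noteq> 0} < card ?K"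
        using fin by (intro psubset_card_mono) auto
      show "0 \<le> p' x" if "x \<in> V" for x using that less.prems(1) uv by (auto simp: p')
      have "sum p' V = sum p V + p v / 2 * (\<Sum>x\<in>V. point_mass u x + point_mass u x - 2 * point_mass v x)"
        by (simp add: p'_def sum.distrib sum_distrib_left)
      also have "(\<Sum>x\<in>V. point_mass u x + point_mass u x - 2 * point_mass v x) = 0"
        using uv fin sum_point_mass[of V _ "\<lambda>_. 1"]
        by (simp add: sum.distrib sum_subtractf flip: sum_distrib_left)
      finally show "sum p' V = 1" using less.prems(2) by simp
    qed
    ultimately show ?thesis by simp
  qed
qed

text \<open>
  At a maximizer the linear exchange of mass between nonadjacent vertices of the support must have slope zero,
  so \<open>u\<close>, \<open>v\<close>, \<open>w\<close> have equal gradients. Then moving mass from \<open>v\<close> to both \<open>u\<close> and \<open>w\<close> changes the form only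
  by the second-order term of the pair \<open>u\<close>, \<open>w\<close>, which would be a strict gain if \<open>uw\<close> were an edge.
\<close>

lemma nonadjacency_transitive_if_extremal:
  assumes G: "simple_graph V E"
    and p: "\<And>v. v \<in> V \<Longrightarrow> 0 \<le> p v" "sum p V = 1"
    and ext: "quad_form V (clique_weight V E) p = 1"
    and V: "u \<in> V" "v \<in> V" "w \<in> V" and pos: "0 < p u" "0 < p v" "0 < p w"
    and nadj: "{u, v} \<notin> E" "{v, w} \<notin> E"
  shows "{u, w} \<notin> E"
proof
  assume uw: "{u, w} \<in> E"
  let ?q = "clique_weight V E"
  have fin: "finite V" using G by (simp add: simple_graph_def)
  define g where "g = (\<lambda>x. \<Sum>y\<in>V. ?q x y * p y)"
  \<comment> \<open>The halving is due to the vertex that loses \<open>2 * e\<close>.\<close>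
  define e where "e = min (p u) (min (p v) (p w)) / 2"
  have e: "0 < e" "2 * e \<le> p u" "2 * e \<le> p v" "2 * e \<le> p w" using pos by (auto simp: e_def)
  have shift: "2 * t * (g a + g c - 2 * g b) + 2 * t^2 * ?q a c \<le> 0"
    if abc: "a \<in> {u, v, w}" "b \<in> {u, v, w}" "c \<in> {u, v, w}" "{a, b} \<notin> E" "{b, c} \<notin> E"
      and t: "\<bar>t\<bar> \<le> e" "a = c \<or> 0 \<le> t" "a \<noteq> b" "b \<noteq> c" for a b c t
  proof -
    define p' where "p' = (\<lambda>x. p x + t * (point_mass a x + point_mass c x - 2 * point_mass b x))"
    have inV: "a \<in> V" "b \<in> V" "c \<in> V" using abc V by auto
    have q0: "?q a b = 0" "?q b c = 0" using abc by (simp_all add: clique_weight_def insert_commute)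
    have "quad_form V ?q p' = 1 + 2 * t * (g a + g c - 2 * g b) + 2 * t^2 * ?q a c"
      using quad_form_shift[where q = "clique_weight V E" and p = p and t = t,
          OF fin inV clique_weight_commute clique_weight_diag[OF G] q0]
      unfolding p'_def g_def by (simp add: ext)
    moreover have "quad_form V ?q p' \<le> 1"
    proof (rule localized_Motzkin_Straus[OF G])
      show "0 \<le> p' x" if "x \<in> V" for x
        using p(1)[OF that] t abc e by (auto simp: p'_def point_mass_def)
      have "sum p' V = sum p V + t * (\<Sum>x\<in>V. point_mass a x + point_mass c x - 2 * point_mass b x)"
        by (simp add: p'_def sum.distrib sum_distrib_left)
      also have "(\<Sum>x\<in>V. point_mass a x + point_mass c x - 2 * point_mass b x) = 0"
        using inV fin sum_point_mass[of V _ "\<lambda>_. 1"]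
        by (simp add: sum.distrib sum_subtractf flip: sum_distrib_left)
      finally show "sum p' V = 1" using p by simp
    qed
    ultimately show ?thesis by simp
  qed
  have neq: "u \<noteq> v" "v \<noteq> w" using uw nadj by (auto simp: insert_commute)
  \<comment> \<open>With both targets equal, mass can be moved in either direction.\<close>
  have "g u = g v"
    using shift[of u v u e] shift[of u v u "-e"] neq nadj e clique_weight_diag[OF G, of u]
    by (auto simp: insert_commute algebra_simps)
  moreover have "g w = g v"
    using shift[of w v w e] shift[of w v w "-e"] neq nadj e clique_weight_diag[OF G, of w]
    by (auto simp: insert_commute algebra_simps)
  ultimately have "e^2 * ?q u w \<le> 0"
    using shift[of u v w e] neq nadj e by (simp add: mult.commute)
  then show False
    using e clique_weight_pos[OF G uw] by (simp add: mult_le_0_iff)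
qed

section \<open>The Perron vector of a graph\<close>

text \<open>
  Eigenvectors of a symmetric matrix for distinct eigenvalues are orthogonal, hence independent.
\<close>

lemma finite_eigenvalues:
  fixes A :: "real ^ 'n ^ 'n"
  assumes sym: "transpose A = A"
  shows "finite (eigenvalues A)"
proof -
  have "\<forall>c\<in>eigenvalues A. \<exists>x. x \<noteq> 0 \<and> A *v x = c *\<^sub>R x" by (simp add: eigenvalues_def)
  then obtain f where f: "\<And>c. c \<in> eigenvalues A \<Longrightarrow> f c \<noteq> 0 \<and> A *v f c = c *\<^sub>R f c"
    by metis
  have orth: "orthogonal (f c) (f d)" if "c \<in> eigenvalues A" "d \<in> eigenvalues A" "c \<noteq> d" for c d
  proof -
    have "(A *v f c) \<bullet> f d = f c \<bullet> (A *v f d)"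
      by (metis dot_lmul_matrix sym transpose_matrix_vector)
    then show ?thesis using f[OF that(1)] f[OF that(2)] that(3) by (simp add: orthogonal_def)
  qed
  have "inj_on f (eigenvalues A)"
  proof
    fix c d assume cd: "c \<in> eigenvalues A" "d \<in> eigenvalues A" "f c = f d"
    then show "c = d" using orth[of c d] f[of c] by (auto simp: orthogonal_def)
  qed
  moreover have "independent (f ` eigenvalues A)"
    using f orth by (intro pairwise_orthogonal_independent) (auto simp: pairwise_def)
  ultimately show ?thesis using finiteI_independent finite_imageD by blast
qed

text \<open>
  The residual \<open>z = A x - \<mu> x\<close> is orthogonal to \<open>x\<close>, and the Rayleigh quotient would increase to first order
  in the direction \<open>z\<close> with slope \<open>2 * (z \<bullet> z)\<close>; so \<open>z\<close> has to vanish.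
\<close>

lemma rayleigh_maximizer_is_eigenvector:
  fixes A :: "real ^ 'n ^ 'n"
  assumes sym: "transpose A = A" and x: "norm x = 1"
    and max: "\<And>y. y \<bullet> (A *v y) \<le> (x \<bullet> (A *v x)) * (y \<bullet> y)"
  shows "A *v x = (x \<bullet> (A *v x)) *\<^sub>R x"
proof -
  define \<mu> where "\<mu> = x \<bullet> (A *v x)"
  define z where "z = A *v x - \<mu> *\<^sub>R x"
  have xx: "x \<bullet> x = 1" using x by (simp add: dot_square_norm)
  have xz: "x \<bullet> z = 0" by (simp add: z_def inner_diff_right xx \<mu>_def)
  have zAx: "z \<bullet> (A *v x) = z \<bullet> z" using xz by (simp add: z_def inner_diff_right inner_commute inner_diff_left)
  have xAz: "x \<bullet> (A *v z) = z \<bullet> z"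
    by (metis dot_lmul_matrix sym transpose_matrix_vector zAx inner_commute)
  define C where "C = \<mu> * (z \<bullet> z) - z \<bullet> (A *v z)"
  have main: "2 * t * (z \<bullet> z) \<le> t^2 * C" for t
    unfolding C_def using max[of "x + t *\<^sub>R z"] xx xz zAx xAz
    by (simp add: matrix_vector_right_distrib matrix_vector_mult_scaleR inner_add_left inner_add_right
        \<mu>_def[symmetric] inner_commute[of z x] algebra_simps power2_eq_square)
  have "z \<bullet> z = 0"
  proof (rule ccontr)
    assume "z \<bullet> z \<noteq> 0"
    then have zz: "0 < z \<bullet> z" by simp
    \<comment> \<open>Small enough for the linear term to beat the quadratic one.\<close>
    define t where "t = (z \<bullet> z) / (\<bar>C\<bar> + 1)"
    have t: "0 < t" using zz by (simp add: t_def add_nonneg_pos)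
    have "2 * t * (z \<bullet> z) \<le> t * (t * C)" using main[of t] by (simp add: power2_eq_square mult.assoc)
    then have "2 * (z \<bullet> z) \<le> t * C" using t by (simp add: mult.assoc mult.left_commute[of 2])
    also have "\<dots> \<le> t * (\<bar>C\<bar> + 1)" using t by (intro mult_left_mono) auto
    also have "\<dots> = z \<bullet> z" by (simp add: t_def add_nonneg_pos field_simps)
    finally show False using zz by simp
  qed
  then show ?thesis by (simp add: z_def \<mu>_def)
qed

text \<open>
  Taking absolute values of the coordinates of a Rayleigh maximizer does not decrease \<open>y \<bullet> (A *v y)\<close> when
  the entries of \<open>A\<close> are nonnegative, so the maximum is also attained at a nonnegative vector.
\<close>

lemma nonneg_matrix_perron_vector:
  fixes A :: "real ^ 'n::finite ^ 'n"
  assumes sym: "transpose A = A" and nonneg: "\<And>i j. 0 \<le> A $ i $ j"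
  obtains x where "norm x = 1" "\<And>i. 0 \<le> x $ i" "A *v x = Max (eigenvalues A) *\<^sub>R x"
    "\<And>y. y \<bullet> (A *v y) \<le> Max (eigenvalues A) * (y \<bullet> y)"
proof -
  have "continuous_on (sphere 0 1) (\<lambda>y. y \<bullet> (A *v y))"
    by (intro continuous_intros matrix_vector_mult_linear_continuous_on)
  moreover have "sphere (0 :: real ^ 'n) 1 \<noteq> {}"
    using norm_axis_1 by (metis (no_types) empty_iff mem_sphere_0)
  ultimately obtain y where y: "norm y = 1"
      and ymax: "\<And>z. norm z = 1 \<Longrightarrow> z \<bullet> (A *v z) \<le> y \<bullet> (A *v y)"
    using continuous_attains_sup[of "sphere (0 :: real ^ 'n) 1" "\<lambda>y. y \<bullet> (A *v y)"]
    by (auto simp: compact_sphere)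
  define x where "x = (\<chi> i. \<bar>y $ i\<bar>)"
  have x1: "norm x = 1" using y by (simp add: x_def norm_vec_def)
  have x0: "0 \<le> x $ i" for i by (simp add: x_def)
  have "y \<bullet> (A *v y) \<le> x \<bullet> (A *v x)"
  proof -
    have "y $ i * (A $ i $ j * y $ j) \<le> \<bar>y $ i\<bar> * (A $ i $ j * \<bar>y $ j\<bar>)" for i j
      using abs_ge_self[of "y $ i * (A $ i $ j * y $ j)"] nonneg[of i j] by (simp add: abs_mult)
    then show ?thesis
      by (auto simp: x_def inner_vec_def matrix_vector_mult_def sum_distrib_left intro!: sum_mono)
  qed
  with ymax have xmax: "z \<bullet> (A *v z) \<le> x \<bullet> (A *v x)" if "norm z = 1" for z
    using that by force
  define \<mu> where "\<mu> = x \<bullet> (A *v x)"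
  have max: "z \<bullet> (A *v z) \<le> \<mu> * (z \<bullet> z)" for z
  proof (cases "z = 0")
    case False
    have "norm ((1 / norm z) *\<^sub>R z) = 1" using False by simp
    from xmax[OF this] have "(z \<bullet> (A *v z)) / (norm z)\<^sup>2 \<le> \<mu>"
      by (simp add: matrix_vector_mult_scaleR \<mu>_def power2_eq_square)
    then show ?thesis using False by (simp add: field_simps dot_square_norm)
  qed simp
  have eig: "A *v x = \<mu> *\<^sub>R x"
    using rayleigh_maximizer_is_eigenvector[OF sym x1] max by (simp add: \<mu>_def)
  have "x \<noteq> 0" using x1 by auto
  have "\<mu> = Max (eigenvalues A)"
  proof (rule Max_eqI[symmetric])
    show "finite (eigenvalues A)" by (rule finite_eigenvalues[OF sym])
    show "\<mu> \<in> eigenvalues A" using eig \<open>x \<noteq> 0\<close> unfolding eigenvalues_def by blast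
    fix c assume "c \<in> eigenvalues A"
    then obtain z where z: "z \<noteq> 0" "A *v z = c *\<^sub>R z" by (auto simp: eigenvalues_def)
    then show "c \<le> \<mu>" using max[of z] by simp
  qed
  then show thesis using that[of x] x1 x0 eig max by simp
qed

abbreviation adj :: "'n::finite set set \<Rightarrow> 'n \<Rightarrow> 'n \<Rightarrow> real" where
  "adj E u v \<equiv> adjacency_matrix E $ u $ v"

lemma adj_eq: "adj E u v = (if {u, v} \<in> E then 1 else 0)"
  by (simp add: adjacency_matrix_def)

lemma adj_commute: "adj E u v = adj E v u"
  by (simp add: adj_eq insert_commute)

lemma adj_nonneg: "0 \<le> adj E u v"
  by (simp add: adj_eq)

lemma transpose_adjacency_matrix: "transpose (adjacency_matrix E) = adjacency_matrix E"
  by (simp add: transpose_def adjacency_matrix_def vec_eq_iff insert_commute)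

lemma eigenvalue_le_graph_index:
  fixes E :: "'n::finite set set"
  assumes "\<And>u. (\<Sum>v\<in>UNIV. adj E u v * y v) = c * y u" and "y a \<noteq> 0"
  shows "c \<le> graph_index E"
proof -
  have "adjacency_matrix E *v (\<chi> v. y v) = c *\<^sub>R (\<chi> v. y v)"
    by (simp add: vec_eq_iff matrix_vector_mult_def assms(1))
  moreover have "(\<chi> v. y v) \<noteq> 0" using assms(2) by (auto simp: vec_eq_iff)
  ultimately have "c \<in> eigenvalues (adjacency_matrix E)" by (auto simp: eigenvalues_def)
  then show ?thesis
    unfolding graph_index_def by (intro Max_ge finite_eigenvalues transpose_adjacency_matrix)
qed

lemma graph_perron_vector:
  fixes E :: "'n::finite set set"
  assumes G: "simple_graph UNIV E" and ne: "E \<noteq> {}"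
  obtains x where "0 < graph_index E" "\<And>v. 0 \<le> x v" "(\<Sum>v\<in>UNIV. (x v)\<^sup>2) = 1"
    "\<And>u. (\<Sum>v\<in>UNIV. adj E u v * x v) = graph_index E * x u"
proof -
  let ?A = "adjacency_matrix E"
  obtain x where x: "norm x = 1" "\<And>i. 0 \<le> x $ i" "?A *v x = graph_index E *\<^sub>R x"
    "\<And>y. y \<bullet> (?A *v y) \<le> graph_index E * (y \<bullet> y)"
    using nonneg_matrix_perron_vector[OF transpose_adjacency_matrix[of E]]
    unfolding graph_index_def by (metis adj_eq zero_le_one order_refl)
  obtain a b where ab: "{a, b} \<in> E" "a \<noteq> b"
    using ne simple_graph_edgeE[OF G] by (metis ex_in_conv)
  define y :: "real ^ 'n" where "y = axis a 1 + axis b 1"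
  have "0 < y \<bullet> (?A *v y)"
    using ab by (simp add: y_def inner_add_left inner_axis' matrix_vector_right_distrib
        matrix_vector_mult_basis column_def adj_eq insert_commute)
  also have "\<dots> \<le> graph_index E * (y \<bullet> y)" by (rule x(4))
  finally have pos: "0 < graph_index E"
    using inner_ge_zero[of y] by (simp add: zero_less_mult_iff)
  show thesis
  proof (rule that[of "\<lambda>v. x $ v"])
    show "(\<Sum>v\<in>UNIV. (x $ v)\<^sup>2) = 1"
      using x(1) by (simp add: norm_vec_def L2_set_def)
    show "(\<Sum>v\<in>UNIV. adj E u v * x $ v) = graph_index E * x $ u" for u
      using arg_cong[OF x(3), of "\<lambda>y. y $ u"] by (simp add: matrix_vector_mult_def)
  qed (use pos x in auto)
qed

section \<open>Walks, degrees and powers of the adjacency matrix\<close>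

text \<open>
  The entries of the powers of the adjacency matrix: \<open>walk_matrix E n u v\<close> counts the walks from \<open>u\<close> to \<open>v\<close>
  with \<open>n\<close> edges, hence on \<open>n + 1\<close> vertices.
\<close>

primrec walk_matrix :: "'n::finite set set \<Rightarrow> nat \<Rightarrow> 'n \<Rightarrow> 'n \<Rightarrow> real" where
  "walk_matrix E 0 u v = of_bool (u = v)"
| "walk_matrix E (Suc n) u v = (\<Sum>w\<in>UNIV. adj E u w * walk_matrix E n w v)"

lemma walk_matrix_nonneg: "0 \<le> walk_matrix E n u v"
  by (induction n arbitrary: u) (auto intro!: sum_nonneg mult_nonneg_nonneg adj_nonneg)

lemma sum_of_bool_eq_mult:
  fixes f :: "'n::finite \<Rightarrow> real"
  shows "(\<Sum>w\<in>UNIV. of_bool (u = w) * f w) = f u"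
  by (simp add: of_bool_def if_distrib[of "\<lambda>a. a * _"] cong: if_cong)

lemma walk_matrix_Suc_right:
  "walk_matrix E (Suc n) u v = (\<Sum>w\<in>UNIV. walk_matrix E n u w * adj E w v)"
proof (induction n arbitrary: u)
  case 0
  then show ?case
    using sum_of_bool_eq_mult[of v "\<lambda>w. adj E u w"]
    by (simp add: sum_of_bool_eq_mult mult.commute[of "adj E u _"] eq_commute[of _ v])
next
  case (Suc n)
  have "walk_matrix E (Suc (Suc n)) u v
      = (\<Sum>w\<in>UNIV. \<Sum>z\<in>UNIV. adj E u w * walk_matrix E n w z * adj E z v)"
    unfolding walk_matrix.simps(2)[of E "Suc n" u v] Suc.IH by (simp only: sum_distrib_left mult.assoc)
  also have "\<dots> = (\<Sum>z\<in>UNIV. walk_matrix E (Suc n) u z * adj E z v)"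
    by (subst sum.swap) (simp add: sum_distrib_right)
  finally show ?case .
qed

lemma walk_matrix_commute: "walk_matrix E n u v = walk_matrix E n v u"
proof (induction n arbitrary: u v)
  case (Suc n)
  show ?case
    unfolding walk_matrix_Suc_right[of E n v u] walk_matrix.simps(2)[of E n u v]
    by (simp add: Suc.IH[of v] mult.commute adj_commute)
qed auto

lemma walk_matrix_eigenvector:
  assumes "\<And>u. (\<Sum>v\<in>UNIV. adj E u v * x v) = c * x u"
  shows "(\<Sum>v\<in>UNIV. walk_matrix E n u v * x v) = c ^ n * x u"
proof (induction n arbitrary: u)
  case 0
  then show ?case by (simp add: sum_of_bool_eq_mult)
next
  case (Suc n)
  have "(\<Sum>v\<in>UNIV. walk_matrix E (Suc n) u v * x v)
     = (\<Sum>w\<in>UNIV. adj E u w * (\<Sum>v\<in>UNIV. walk_matrix E n w v * x v))"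
    by (simp add: sum_distrib_right sum_distrib_left mult.assoc) (subst sum.swap, simp)
  also have "\<dots> = c ^ n * (\<Sum>w\<in>UNIV. adj E u w * x w)"
    unfolding Suc.IH by (simp add: sum_distrib_left mult_ac)
  finally show ?case unfolding assms by (simp only: power_Suc mult_ac)
qed

text \<open>
  Walking back and forth along the edge. This makes the tightness of all walks informative about \<open>v\<close> and \<open>u\<close>
  when the length is odd, and at least nonvacuous when it is even.
\<close>

lemma walk_matrix_edge_pos:
  assumes "{u, v} \<in> E"
  shows "0 < walk_matrix E n v (if even n then v else u)"
  using assms
proof (induction n arbitrary: u v)
  case (Suc n)
  let ?z = "if even (Suc n) then v else u"
  have "{v, u} \<in> E" using Suc.prems by (simp add: insert_commute)
  from Suc.IH[OF this] have "0 < adj E v u * walk_matrix E n u ?z"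
    using \<open>{v, u} \<in> E\<close> by (auto simp: adj_eq split: if_splits)
  also have "\<dots> \<le> walk_matrix E (Suc n) v ?z"
    unfolding walk_matrix.simps by (rule member_le_sum) (auto simp: walk_matrix_nonneg adj_nonneg)
  finally show ?case .
qed auto

lemma num_walks_1: "num_walks E (Suc 0) v = 1"
proof -
  have "walks_from E (Suc 0) v = {[v]}"
    by (auto simp: walks_from_def length_Suc_conv)
  then show ?thesis by (simp add: num_walks_def)
qed

lemma num_walks_Suc:
  fixes E :: "'n::finite set set"
  shows "real (num_walks E (Suc (Suc n)) v) = (\<Sum>u\<in>UNIV. adj E v u * real (num_walks E (Suc n) u))"
proof -
  let ?N = "{u. {v, u} \<in> E}"
  have fin: "finite (walks_from E k u)" for k u
    using finite_lists_length_eq[of "UNIV :: 'n set" k]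
    by (rule finite_subset[rotated]) (auto simp: walks_from_def)
  have "walks_from E (Suc (Suc n)) v = (\<Union>u\<in>?N. (#) v ` walks_from E (Suc n) u)"
    by (fastforce simp: walks_from_def length_Suc_conv)
  then have "num_walks E (Suc (Suc n)) v = (\<Sum>u\<in>?N. card ((#) v ` walks_from E (Suc n) u))"
    unfolding num_walks_def using fin
    by (simp only:, intro card_UN_disjoint) (auto simp: walks_from_def)
  also have "\<dots> = (\<Sum>u\<in>?N. num_walks E (Suc n) u)"
    by (intro sum.cong refl) (simp add: num_walks_def card_image)
  finally show ?thesis
    by (simp add: adj_eq if_distrib[of "\<lambda>a. a * _"] sum.If_cases cong: if_cong)
qed

lemma num_walks_eq_row_sum:
  "real (num_walks E (Suc n) v) = (\<Sum>z\<in>UNIV. walk_matrix E n v z)"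
proof (induction n arbitrary: v)
  case 0
  then show ?case by (simp add: num_walks_1)
next
  case (Suc n)
  then show ?case
    by (simp add: num_walks_Suc sum_distrib_left) (rule sum.swap)
qed

text \<open>
  Each edge appears twice on the right, once for each choice of the end \<open>v\<close> at which \<open>g\<close> is evaluated.
\<close>

lemma sum_edges_sum_ends:
  fixes E :: "'n::finite set set"
  fixes f :: "'n set \<Rightarrow> real"
  assumes G: "simple_graph UNIV E"
  shows "(\<Sum>e\<in>E. f e * (\<Sum>v\<in>e. g v)) = (\<Sum>u\<in>UNIV. \<Sum>v\<in>UNIV. adj E u v * f {u, v} * g v)"
    (is "?L = ?R")
proof -
  have "?L = (\<Sum>e\<in>E. \<Sum>v\<in>UNIV. of_bool (v \<in> e) * (f e * g v))"
    by (simp add: sum_distrib_left of_bool_def if_distrib[of "\<lambda>a. a * _"] sum.If_cases cong: if_cong)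
  also have "\<dots> = (\<Sum>v\<in>UNIV. \<Sum>e\<in>E. of_bool (v \<in> e) * (f e * g v))"
    by (rule sum.swap)
  also have "\<dots> = (\<Sum>v\<in>UNIV. \<Sum>u\<in>UNIV. adj E u v * (f {u, v} * g v))"
  proof (intro sum.cong refl)
    fix v
    have inj: "inj_on (\<lambda>u. {u, v}) {u. {u, v} \<in> E}"
      by (auto simp: inj_on_def doubleton_eq_iff)
    have img: "{e \<in> E. v \<in> e} = (\<lambda>u. {u, v}) ` {u. {u, v} \<in> E}"
    proof (intro equalityI subsetI)
      fix e assume e: "e \<in> {e \<in> E. v \<in> e}"
      then have "card e = 2" using G by (auto simp: simple_graph_def nsets_def)
      then obtain u where "e = {u, v}" using e by (auto simp: card_2_iff)
      then show "e \<in> (\<lambda>u. {u, v}) ` {u. {u, v} \<in> E}" using e by auto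
    qed auto
    have "(\<Sum>e\<in>E. of_bool (v \<in> e) * (f e * g v)) = (\<Sum>e\<in>{e \<in> E. v \<in> e}. f e * g v)"
      by (simp add: of_bool_def if_distrib[of "\<lambda>a. a * _"] sum.If_cases Int_def cong: if_cong)
    also have "\<dots> = (\<Sum>u\<in>{u. {u, v} \<in> E}. f {u, v} * g v)"
      unfolding img by (simp add: sum.reindex[OF inj])
    finally show "(\<Sum>e\<in>E. of_bool (v \<in> e) * (f e * g v)) = (\<Sum>u\<in>UNIV. adj E u v * (f {u, v} * g v))"
      by (simp add: adj_eq if_distrib[of "\<lambda>a. a * _"] sum.If_cases cong: if_cong)
  qed
  finally show ?thesis by (subst sum.swap) (simp add: mult.assoc)
qed

lemma degree_eq_sum:
  fixes E :: "'n::finite set set"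
  assumes G: "simple_graph UNIV E"
  shows "real (degree E v) = (\<Sum>u\<in>UNIV. adj E v u)"
proof -
  have "real (degree E v) = (\<Sum>e\<in>E. 1 * (\<Sum>w\<in>e. if w = v then 1 else 0))"
    by (simp add: degree_def sum.If_cases Int_def)
  also have "\<dots> = (\<Sum>u\<in>UNIV. \<Sum>w\<in>UNIV. adj E u w * 1 * (if w = v then 1 else 0))"
    by (rule sum_edges_sum_ends[OF G])
  also have "\<dots> = (\<Sum>u\<in>UNIV. adj E u v)"
    by (simp add: if_distrib[of "\<lambda>a. _ * a"] cong: if_cong)
  finally show ?thesis by (simp add: adj_commute)
qed

lemma degree_eq_card_neighbours:
  fixes E :: "'n::finite set set"
  assumes "simple_graph UNIV E"
  shows "degree E v = card {u. {v, u} \<in> E}"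
proof -
  have "real (degree E v) = real (card {u. {v, u} \<in> E})"
    by (simp add: degree_eq_sum[OF assms] adj_eq sum.If_cases)
  then show ?thesis by simp
qed

lemma nonisolated_iff:
  fixes E :: "'n::finite set set"
  assumes G: "simple_graph UNIV E"
  shows "v \<in> UNIV - isolated_vertices UNIV E \<longleftrightarrow> (\<exists>u. {u, v} \<in> E)"
  by (auto simp: isolated_vertices_def degree_eq_card_neighbours[OF G] insert_commute)

section \<open>Entropy of the walk distribution\<close>

text \<open>
  Here \<open>B\<close> plays the role of the \<open>n\<close>-th power of \<open>A\<close>. The argument is a termwise comparison
  of \<open>A u v * m u v * B v z\<close> with a lower bound \<open>H u v z\<close> that contains \<open>ln (x v) - ln (x z)\<close>. This difference
  is absent from the sum: since \<open>x\<close> is an eigenvector of both \<open>A\<close> and \<open>B\<close>, summing \<open>A u v * B v z * x u * x z\<close>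
  over \<open>u\<close> and \<open>z\<close> for fixed \<open>v\<close>, or over \<open>u\<close> and \<open>v\<close> for fixed \<open>z\<close>, gives the same multiple of the squared
  entry of \<open>x\<close> at the fixed vertex. Equality of the sums forces equality in every term, that is, in
  both uses of \<open>ln t \<le> t - 1\<close>, whose only equality case is \<open>t = 1\<close>.
\<close>

lemma tilted_entropy_bound:
  fixes A m B :: "'n::finite \<Rightarrow> 'n \<Rightarrow> real" and x :: "'n \<Rightarrow> real" and c :: real
  assumes c: "0 < c" and x: "\<And>v. 0 \<le> x v"
    and A: "\<And>u v. 0 \<le> A u v" "\<And>u v. A u v = A v u" "\<And>u. (\<Sum>v\<in>UNIV. A u v * x v) = c * x u"
    and B: "\<And>u v. 0 \<le> B u v" "\<And>u v. B u v = B v u" "\<And>u. (\<Sum>v\<in>UNIV. B u v * x v) = c ^ n * x u"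
    and m: "\<And>u v. 0 < A u v \<Longrightarrow> 0 < m u v"
    and x1: "(\<Sum>v\<in>UNIV. (x v)\<^sup>2) = 1"
  defines "S \<equiv> (\<Sum>u\<in>UNIV. \<Sum>v\<in>UNIV. A u v * m u v * (\<Sum>z\<in>UNIV. B v z))"
    and "T \<equiv> c ^ (n + 2) * (2 - (\<Sum>u\<in>UNIV. \<Sum>v\<in>UNIV. A u v / m u v * (x u)\<^sup>2 * (x v)\<^sup>2))"
  shows "T \<le> S"
    and "S = T \<Longrightarrow> 0 < A u v \<Longrightarrow> 0 < B v z \<Longrightarrow>
       0 < x u \<and> 0 < x v \<and> 0 < x z \<and> m u v = c * x u * x v \<and> x v = x z"
proof -
  define F where "F = (\<lambda>u v z. A u v * B v z * m u v)"
  define H where "H = (\<lambda>u v z. c * (A u v * B v z) * (x u * x z) *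
      (2 - c * x u * x v / m u v + ln (x v) - ln (x z)))"
  have xv: "0 < x v" if "0 < x u" "0 < A u v" for u v
  proof -
    have "0 < A v u * x u" using that A(2) by simp
    also have "\<dots> \<le> c * x v" unfolding A(3)[of v, symmetric]
      by (rule member_le_sum) (auto simp: A x)
    finally show ?thesis using c by (simp add: zero_less_mult_iff)
  qed
  have termwise: "H u v z \<le> F u v z \<and> (H u v z = F u v z \<longrightarrow> 0 < A u v \<longrightarrow> 0 < B v z \<longrightarrow>
      0 < x u \<and> 0 < x v \<and> 0 < x z \<and> m u v = c * x u * x v \<and> x v = x z)" for u v z
  proof (cases "0 < A u v \<and> 0 < B v z")
    case False
    then have "A u v = 0 \<or> B v z = 0" using A(1)[of u v] B(1)[of v z] by auto
    then show ?thesis using False by (auto simp: H_def F_def)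
  next
    case AB: True
    then have m0: "0 < m u v" using m by blast
    show ?thesis
    proof (cases "0 < x u \<and> 0 < x z")
      case False
      then have "x u * x z = 0" using x[of u] x[of z] by auto
      then show ?thesis using AB m0 by (auto simp: H_def F_def)
    next
      case True
      then have v0: "0 < x v" using xv AB by blast
      \<comment> \<open>\<open>ln s \<le> s - 1\<close> compares the two weights of a walk, \<open>ln t \<le> t - 1\<close> removes the logarithm of the edge weight;
        their sum leaves only \<open>ln (s * t)\<close>, which involves \<open>v\<close> and \<open>z\<close> alone.\<close>
      define s where "s = m u v / (c * x u * x z)"
      define t where "t = c * x u * x v / m u v"
      have st: "0 < s" "0 < t" using True v0 c m0 by (auto simp: s_def t_def)
      have "s * t = x v / x z" using True v0 c m0 by (simp add: s_def t_def field_simps)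
      then have ln: "ln (x v) - ln (x z) = ln s + ln t"
        using st v0 True by (metis ln_div ln_mult order_less_irrefl)
      have F: "F u v z = c * (A u v * B v z) * (x u * x z) * s"
        using True c by (simp add: F_def s_def field_simps)
      have H: "H u v z = c * (A u v * B v z) * (x u * x z) * (2 - t + ln s + ln t)"
        using ln by (simp add: H_def t_def)
      define K where "K = c * (A u v * B v z) * (x u * x z)"
      have K: "0 < K" using AB True c by (simp add: K_def)
      have le: "ln s \<le> s - 1" "ln t \<le> t - 1" using st by (simp_all add: ln_le_minus_one)
      then have "2 - t + ln s + ln t \<le> s" by simp
      moreover have "s = 1 \<and> t = 1" if "2 - t + ln s + ln t = s"
        using that le st ln_eq_minus_one[of s] ln_eq_minus_one[of t] by linarith
      moreover have "m u v = c * x u * x v \<and> x v = x z" if "s = 1 \<and> t = 1"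
      proof -
        have "x v / x z = 1" using that \<open>s * t = x v / x z\<close> by simp
        moreover have "t = 1" using that ..
        ultimately show ?thesis using True m0 unfolding t_def by (simp add: field_simps)
      qed
      ultimately show ?thesis
        unfolding F H K_def[symmetric] using K v0 True by (auto intro: mult_left_mono)
    qed
  qed
  have sumF: "(\<Sum>u\<in>UNIV. \<Sum>v\<in>UNIV. \<Sum>z\<in>UNIV. F u v z) = S"
    by (simp add: F_def S_def sum_distrib_left mult_ac)
  have sumA: "(\<Sum>u\<in>UNIV. A u v * x u) = c * x v" for v
    using A(3)[of v] by (simp only: A(2)[of _ v])
  have sumB: "(\<Sum>v\<in>UNIV. B v z * x v) = c ^ n * x z" for z
    using B(3)[of z] by (simp only: B(2)[of _ z])
  have sumH: "(\<Sum>u\<in>UNIV. \<Sum>v\<in>UNIV. \<Sum>z\<in>UNIV. H u v z) = T"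
  proof -
    define \<Phi> where "\<Phi> = (\<Sum>v\<in>UNIV. (x v)\<^sup>2 * ln (x v))"
    define Q where "Q = (\<Sum>u\<in>UNIV. \<Sum>v\<in>UNIV. A u v / m u v * (x u)\<^sup>2 * (x v)\<^sup>2)"
    have Bz: "(\<Sum>z\<in>UNIV. a * (B v z * x z)) = a * (c ^ n * x v)" for a v
      by (simp add: B(3) flip: sum_distrib_left)
    have 1: "(\<Sum>u\<in>UNIV. \<Sum>v\<in>UNIV. \<Sum>z\<in>UNIV. c * A u v * x u * f u v * (B v z * x z))
       = c ^ (n + 1) * (\<Sum>u\<in>UNIV. \<Sum>v\<in>UNIV. A u v * x u * x v * f u v)" for f
      unfolding Bz by (simp add: sum_distrib_left mult_ac)
    have 2: "(\<Sum>u\<in>UNIV. \<Sum>v\<in>UNIV. A u v * x u * x v * f v) = c * (\<Sum>v\<in>UNIV. (x v)\<^sup>2 * f v)" for f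
    proof -
      have "(\<Sum>u\<in>UNIV. \<Sum>v\<in>UNIV. A u v * x u * x v * f v) = (\<Sum>v\<in>UNIV. \<Sum>u\<in>UNIV. A u v * x u * (x v * f v))"
        by (subst sum.swap) (simp add: mult_ac)
      also have "\<dots> = (\<Sum>v\<in>UNIV. c * x v * (x v * f v))"
        by (simp only: sum_distrib_right[symmetric] sumA)
      finally show ?thesis by (simp add: sum_distrib_left power2_eq_square mult_ac)
    qed
    have 3: "(\<Sum>u\<in>UNIV. \<Sum>v\<in>UNIV. \<Sum>z\<in>UNIV. c * A u v * x u * (B v z * x z) * ln (x z)) = c ^ (n + 2) * \<Phi>"
    proof -
      have "(\<Sum>u\<in>UNIV. \<Sum>v\<in>UNIV. \<Sum>z\<in>UNIV. c * A u v * x u * (B v z * x z) * ln (x z))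
        = (\<Sum>v\<in>UNIV. \<Sum>u\<in>UNIV. (A u v * x u) * (\<Sum>z\<in>UNIV. c * (B v z * x z) * ln (x z)))"
        by (subst sum.swap) (simp add: sum_distrib_left mult_ac)
      also have "\<dots> = (\<Sum>v\<in>UNIV. \<Sum>z\<in>UNIV. c * (c * x v) * (B v z * x z) * ln (x z))"
        by (simp only: sum_distrib_right[symmetric] sumA) (simp add: sum_distrib_left mult_ac)
      also have "\<dots> = (\<Sum>z\<in>UNIV. \<Sum>v\<in>UNIV. (B v z * x v) * (c * c * x z * ln (x z)))"
        by (subst sum.swap) (simp add: mult_ac)
      also have "\<dots> = c ^ (n + 2) * \<Phi>"
        by (simp only: sum_distrib_right[symmetric] sumB)
           (simp add: \<Phi>_def sum_distrib_left power2_eq_square mult_ac)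
      finally show ?thesis .
    qed
    have "(\<Sum>u\<in>UNIV. \<Sum>v\<in>UNIV. \<Sum>z\<in>UNIV. H u v z)
      = (\<Sum>u\<in>UNIV. \<Sum>v\<in>UNIV. \<Sum>z\<in>UNIV. c * A u v * x u * (2 + ln (x v)) * (B v z * x z))
       - (\<Sum>u\<in>UNIV. \<Sum>v\<in>UNIV. \<Sum>z\<in>UNIV. c * A u v * x u * (c * x u * x v / m u v) * (B v z * x z))
       - (\<Sum>u\<in>UNIV. \<Sum>v\<in>UNIV. \<Sum>z\<in>UNIV. c * A u v * x u * (B v z * x z) * ln (x z))"
      unfolding H_def by (simp add: algebra_simps sum_subtractf[symmetric] sum.distrib[symmetric])
    also have "\<dots> = c ^ (n + 1) * (c * (\<Sum>v\<in>UNIV. (x v)\<^sup>2 * (2 + ln (x v)))) - c ^ (n + 2) * Q - c ^ (n + 2) * \<Phi>"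
      unfolding 1 2 3 by (simp add: Q_def sum_distrib_left power2_eq_square mult_ac)
    also have "(\<Sum>v\<in>UNIV. (x v)\<^sup>2 * (2 + ln (x v))) = 2 + \<Phi>"
      by (simp add: distrib_left sum.distrib \<Phi>_def x1 flip: sum_distrib_right)
    finally show ?thesis by (simp add: T_def Q_def algebra_simps)
  qed
  show "T \<le> S" unfolding sumF[symmetric] sumH[symmetric] by (intro sum_mono) (use termwise in blast)
  assume eq: "S = T" and pos: "0 < A u v" "0 < B v z"
  have "(\<Sum>u\<in>UNIV. \<Sum>v\<in>UNIV. \<Sum>z\<in>UNIV. F u v z - H u v z) = 0"
    using eq sumF sumH by (simp add: sum_subtractf)
  then have "F u v z - H u v z = 0"
    using termwise by (simp add: sum_nonneg_eq_0_iff sum_nonneg)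
  then show "0 < x u \<and> 0 < x v \<and> 0 < x z \<and> m u v = c * x u * x v \<and> x v = x z"
    using termwise[of u v z] pos by simp
qed

section \<open>Complete multipartite graphs\<close>

text \<open>
  The edge set in \<open>complete_partite\<close> with the partition as an argument, so that one fixed partition can be used
  to compute clique numbers, neighbourhoods and degrees.
\<close>

definition multipartite_edges :: "'a set set \<Rightarrow> 'a set set" where
  "multipartite_edges P = {{u, v} | u v. \<exists>A\<in>P. \<exists>B\<in>P. A \<noteq> B \<and> u \<in> A \<and> v \<in> B}"

lemma complete_partite_iff:
  "complete_partite k V E \<longleftrightarrow> (\<exists>P. partition_on V P \<and> card P = k \<and> E = multipartite_edges P)"
  by (simp add: complete_partite_def multipartite_edges_def)

lemma multipartite_edges_iff:
  "{u, v} \<in> multipartite_edges P \<longleftrightarrow> (\<exists>A\<in>P. \<exists>B\<in>P. A \<noteq> B \<and> u \<in> A \<and> v \<in> B)"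
proof
  assume "{u, v} \<in> multipartite_edges P"
  then obtain a b A B where *: "{u, v} = {a, b}" and AB: "A \<in> P" "B \<in> P" "A \<noteq> B" "a \<in> A" "b \<in> B"
    unfolding multipartite_edges_def mem_Collect_eq by metis
  from * consider "u = a" "v = b" | "u = b" "v = a" by (auto simp: doubleton_eq_iff)
  then show "\<exists>A\<in>P. \<exists>B\<in>P. A \<noteq> B \<and> u \<in> A \<and> v \<in> B"
  proof cases
    case 1
    with AB show ?thesis by blast
  next
    case 2
    with AB show ?thesis by metis
  qed
next
  assume "\<exists>A\<in>P. \<exists>B\<in>P. A \<noteq> B \<and> u \<in> A \<and> v \<in> B"
  then show "{u, v} \<in> multipartite_edges P"
    unfolding multipartite_edges_def mem_Collect_eq by (intro exI[of _ u] exI[of _ v] conjI refl)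
qed

lemma partition_on_same_part:
  assumes "partition_on W P" "A \<in> P" "B \<in> P" "v \<in> A" "v \<in> B"
  shows "A = B"
proof (rule ccontr)
  assume "A \<noteq> B"
  then have "disjnt A B" using partition_onD2[OF assms(1)] assms(2,3) by (simp add: pairwise_def)
  then show False using assms(4,5) by (simp add: disjnt_iff)
qed

lemma neighbours_in_multipartite:
  assumes P: "partition_on W P" and A: "A \<in> P" "v \<in> A"
  shows "{u. {v, u} \<in> multipartite_edges P} = W - A"
proof (intro equalityI subsetI)
  fix u assume "u \<in> {u. {v, u} \<in> multipartite_edges P}"
  then obtain B C where "B \<in> P" "C \<in> P" "B \<noteq> C" "v \<in> B" "u \<in> C"
    by (auto simp: multipartite_edges_iff)
  moreover from this have "B = A" using partition_on_same_part[OF P] A by metis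
  ultimately have "u \<in> W" "u \<notin> A"
    using partition_on_same_part[OF P] partition_onD1[OF P] by (blast, metis)
  then show "u \<in> W - A" by simp
next
  fix u assume "u \<in> W - A"
  then obtain C where "C \<in> P" "u \<in> C" "C \<noteq> A" using partition_onD1[OF P] by blast
  then show "u \<in> {u. {v, u} \<in> multipartite_edges P}"
    using A unfolding mem_Collect_eq multipartite_edges_iff by blast
qed

lemma clique_card_le_parts:
  assumes P: "partition_on W P" "finite P" "P \<noteq> {}" and K: "finite K" "clique K (multipartite_edges P)"
  shows "card K \<le> card P"
proof (cases "card K \<le> 1")
  case True
  moreover have "1 \<le> card P" using P by (simp add: Suc_le_eq card_gt_0_iff)
  ultimately show ?thesis by simp
next
  case False
  have part: "\<exists>A\<in>P. v \<in> A" if v: "v \<in> K" for v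
  proof -
    have "\<not> K \<subseteq> {v}" using False card_mono[of "{v}" K] by auto
    then obtain u where "u \<in> K" "u \<noteq> v" by blast
    then have "{v, u} \<in> multipartite_edges P" using K v by (auto simp: clique_def)
    then show ?thesis by (auto simp: multipartite_edges_iff)
  qed
  then have "\<forall>v\<in>K. \<exists>A. A \<in> P \<and> v \<in> A" by blast
  then obtain f where "\<forall>v\<in>K. f v \<in> P \<and> v \<in> f v" by (rule bchoice[elim_format]) blast
  then have f: "\<And>v. v \<in> K \<Longrightarrow> f v \<in> P \<and> v \<in> f v" by blast
  have "inj_on f K"
  proof (rule inj_onI, rule ccontr)
    fix u v assume uv: "u \<in> K" "v \<in> K" "f u = f v" "u \<noteq> v"
    then have "{u, v} \<in> multipartite_edges P" using K by (auto simp: clique_def)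
    then obtain A B where "A \<in> P" "B \<in> P" "A \<noteq> B" "u \<in> A" "v \<in> B"
      by (auto simp: multipartite_edges_iff)
    moreover have "f u \<in> P" "u \<in> f u" "v \<in> f u" using f[of u] f[of v] uv by simp_all
    ultimately have "A = f u" "B = f u" using partition_on_same_part[OF P(1)] by blast+
    with \<open>A \<noteq> B\<close> show False by simp
  qed
  then show ?thesis using f P by (intro card_inj_on_le[of f]) auto
qed

text \<open>
  One vertex is chosen from every part, namely \<open>u\<close> and \<open>v\<close> from their own parts.
\<close>

lemma clique_transversal_through_edge:
  assumes P: "partition_on W P" and e: "{u, v} \<in> multipartite_edges P"
  obtains K where "K \<subseteq> W" "clique K (multipartite_edges P)" "{u, v} \<subseteq> K" "card K = card P"
proof -
  obtain A B where AB: "A \<in> P" "B \<in> P" "A \<noteq> B" "u \<in> A" "v \<in> B"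
    using e by (auto simp: multipartite_edges_iff)
  define f where "f = (\<lambda>C. if C = A then u else if C = B then v else SOME x. x \<in> C)"
  have f: "f C \<in> C" if "C \<in> P" for C
  proof -
    have "C \<noteq> {}" using partition_onD3[OF P] that by blast
    then have "(SOME x. x \<in> C) \<in> C" by (simp add: some_in_eq)
    then show ?thesis using AB by (simp add: f_def)
  qed
  have inj: "inj_on f P"
  proof (rule inj_onI)
    fix C D assume CD: "C \<in> P" "D \<in> P" "f C = f D"
    have "f C \<in> C" "f C \<in> D" using f[OF CD(1)] f[OF CD(2)] unfolding CD(3) by simp_all
    then show "C = D" by (rule partition_on_same_part[OF P CD(1,2)])
  qed
  show thesis
  proof (rule that[of "f ` P"])
    show "f ` P \<subseteq> W" using f partition_onD1[OF P] by blast
    show "clique (f ` P) (multipartite_edges P)"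
      unfolding clique_def
    proof (intro ballI impI)
      fix s t assume "s \<in> f ` P" "t \<in> f ` P" "s \<noteq> t"
      then obtain C D where "C \<in> P" "D \<in> P" "C \<noteq> D" "s = f C" "t = f D" by auto
      then show "{s, t} \<in> multipartite_edges P"
        unfolding multipartite_edges_iff using f by blast
    qed
    have "f A = u" "f B = v" using AB by (simp_all add: f_def)
    then show "{u, v} \<subseteq> f ` P" using AB by blast
    show "card (f ` P) = card P" by (rule card_image[OF inj])
  qed
qed

lemma multipartite_edge_clique_number:
  assumes P: "partition_on W P" "W \<subseteq> V" "finite V" and e: "{u, v} \<in> multipartite_edges P"
  shows "edge_clique_number V (multipartite_edges P) {u, v} = card P"
    and "clique_number V (multipartite_edges P) = card P"
proof -
  let ?E = "multipartite_edges P"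
  obtain K where K: "K \<subseteq> W" "clique K ?E" "{u, v} \<subseteq> K" "card K = card P"
    by (rule clique_transversal_through_edge[OF P(1) e])
  have "finite W" using P finite_subset by blast
  then have finP: "finite P" using P(1) by (simp add: finite_elements)
  have ne: "P \<noteq> {}" using e by (auto simp: multipartite_edges_iff)
  have le: "card L \<le> card P" if "L \<subseteq> V" "clique L ?E" for L
    using clique_card_le_parts[OF P(1) finP ne] that P(3) finite_subset by blast
  show "edge_clique_number V ?E {u, v} = card P"
    unfolding edge_clique_number_def using K P le by (intro Max_eqI) (auto intro!: image_eqI[of _ _ K])
  show "clique_number V ?E = card P"
    unfolding clique_number_def using K P le by (intro Max_eqI) (auto intro!: image_eqI[of _ _ K])
qed

text \<open>
  Nonadjacency is reflexive and symmetric in any simple graph; once it is transitive, its classes are the parts.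
\<close>

lemma complete_multipartite_if_nonadjacency_transitive:
  assumes G: "simple_graph V E" and sub: "\<And>u v. {u, v} \<in> E \<Longrightarrow> u \<in> W \<and> v \<in> W"
    and tr: "\<And>u v w. u \<in> W \<Longrightarrow> v \<in> W \<Longrightarrow> w \<in> W \<Longrightarrow> {u, v} \<notin> E \<Longrightarrow> {v, w} \<notin> E \<Longrightarrow> {u, w} \<notin> E"
  obtains P where "partition_on W P" "E = multipartite_edges P"
proof -
  define R where "R = {(u, v). u \<in> W \<and> v \<in> W \<and> {u, v} \<notin> E}"
  have R: "equiv W R"
  proof (rule equivI)
    show "R \<subseteq> W \<times> W" by (auto simp: R_def)
    have "{x} \<notin> E" for x using simple_graph_edgeD(3)[OF G, of x x] by auto
    then show "refl_on W R" by (intro refl_onI) (auto simp: R_def)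
    show "sym R" by (auto simp: sym_def R_def insert_commute)
    show "trans R" unfolding trans_def R_def using tr by blast
  qed
  have P: "partition_on W (W // R)" by (rule partition_on_quotient[OF R])
  have iff: "{u, v} \<in> E \<longleftrightarrow> {u, v} \<in> multipartite_edges (W // R)" for u v
  proof
    assume e: "{u, v} \<in> E"
    then have uv: "u \<in> W" "v \<in> W" using sub by auto
    have "(u, v) \<notin> R" using e by (simp add: R_def)
    then have "R `` {u} \<noteq> R `` {v}" using uv R by (simp add: eq_equiv_class_iff)
    then show "{u, v} \<in> multipartite_edges (W // R)"
      unfolding multipartite_edges_iff using uv R
      by (meson equiv_class_self quotientI)
  next
    assume "{u, v} \<in> multipartite_edges (W // R)"
    then obtain A B where AB: "A \<in> W // R" "B \<in> W // R" "A \<noteq> B" "u \<in> A" "v \<in> B"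
      by (auto simp: multipartite_edges_iff)
    then have "(u, v) \<notin> R" using R by (metis quotient_eqI)
    moreover have "u \<in> W" "v \<in> W" using AB partition_onD1[OF P] by auto
    ultimately show "{u, v} \<in> E" by (simp add: R_def)
  qed
  have "e \<in> E \<longleftrightarrow> e \<in> multipartite_edges (W // R)" for e
  proof -
    have "\<exists>u v. e = {u, v}" if "e \<in> E \<or> e \<in> multipartite_edges (W // R)"
      using that simple_graph_edgeE[OF G] unfolding multipartite_edges_def by blast
    then show ?thesis using iff by blast
  qed
  then show thesis using that[OF P] by blast
qed

section \<open>The inequality and its extremal graphs\<close>

definition clique_walk_sum :: "'n::finite set set \<Rightarrow> nat \<Rightarrow> real" where
  "clique_walk_sum E r = (\<Sum>e\<in>E. (real (edge_clique_number UNIV E e) - 1) / real (edge_clique_number UNIV E e)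
     * (\<Sum>v\<in>e. real (num_walks E (r - 1) v)))"

text \<open>
  On edges this is the reciprocal of \<open>clique_weight\<close>. It weights the first step of a walk, while
  \<open>clique_weight\<close> weights the quadratic form.
\<close>

definition turan_factor :: "'n::finite set set \<Rightarrow> 'n \<Rightarrow> 'n \<Rightarrow> real" where
  "turan_factor E u v = (real (edge_clique_number UNIV E {u, v}) - 1) / real (edge_clique_number UNIV E {u, v})"

lemma clique_walk_sum_eq:
  assumes "simple_graph UNIV E"
  shows "clique_walk_sum E (n + 2) = (\<Sum>u\<in>UNIV. \<Sum>v\<in>UNIV. adj E u v * turan_factor E u v * real (num_walks E (Suc n) v))"
  unfolding clique_walk_sum_def turan_factor_def sum_edges_sum_ends[OF assms] by simp

text \<open>
  With \<open>F\<close> the value of the Motzkin--Straus form at the squared Perron vector, the entropy bound gives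
  \<open>\<lambda>^(n+2) * (2 - F) \<le> S\<close>, and \<open>F \<le> 1\<close>. Equality therefore makes both the entropy bound and
  the Motzkin--Straus inequality sharp; the second part records what the former says on edges.
\<close>

lemma index_pow_le_clique_walk_sum:
  fixes E :: "'n::finite set set"
  assumes G: "simple_graph UNIV E" and ne: "E \<noteq> {}"
  shows "graph_index E ^ (n + 2) \<le> clique_walk_sum E (n + 2)"
    and "graph_index E ^ (n + 2) = clique_walk_sum E (n + 2) \<Longrightarrow> \<exists>x.
      (\<forall>u. (\<Sum>v\<in>UNIV. adj E u v * x v) = graph_index E * x u) \<and>
      (\<forall>u v. {u, v} \<in> E \<longrightarrow> 0 < x u \<and> graph_index E * x u * x v = turan_factor E u v \<and> (odd n \<longrightarrow> x u = x v)) \<and>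
      (\<Sum>v\<in>UNIV. (x v)\<^sup>2) = 1 \<and> quad_form UNIV (clique_weight UNIV E) (\<lambda>v. (x v)\<^sup>2) = 1"
proof -
  let ?l = "graph_index E" and ?B = "walk_matrix E n"
  obtain x where l: "0 < ?l" and x: "\<And>v. 0 \<le> x v" "(\<Sum>v\<in>UNIV. (x v)\<^sup>2) = 1"
    and eig: "\<And>u. (\<Sum>v\<in>UNIV. adj E u v * x v) = ?l * x u"
    using graph_perron_vector[OF G ne] by metis
  define F where "F = (\<Sum>u\<in>UNIV. \<Sum>v\<in>UNIV. adj E u v / turan_factor E u v * (x u)\<^sup>2 * (x v)\<^sup>2)"
  have m: "0 < turan_factor E u v" if "0 < adj E u v" for u v
    using edge_clique_number_ge_2[OF G, of u v] that by (simp add: turan_factor_def adj_eq split: if_splits)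
  have "F = quad_form UNIV (clique_weight UNIV E) (\<lambda>v. (x v)\<^sup>2)"
    unfolding F_def quad_form_def
    by (intro sum.cong refl) (simp add: clique_weight_def turan_factor_def adj_eq)
  moreover have "quad_form UNIV (clique_weight UNIV E) (\<lambda>v. (x v)\<^sup>2) \<le> 1"
    by (rule localized_Motzkin_Straus[OF G]) (simp_all add: x)
  ultimately have F: "F = quad_form UNIV (clique_weight UNIV E) (\<lambda>v. (x v)\<^sup>2)" "F \<le> 1" by auto
  have S: "clique_walk_sum E (n + 2) = (\<Sum>u\<in>UNIV. \<Sum>v\<in>UNIV. adj E u v * turan_factor E u v * (\<Sum>z\<in>UNIV. ?B v z))"
    unfolding clique_walk_sum_eq[OF G] num_walks_eq_row_sum ..
  note tilted = tilted_entropy_bound[where n = n and m = "turan_factor E",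
      OF l x(1) adj_nonneg adj_commute eig walk_matrix_nonneg walk_matrix_commute
        walk_matrix_eigenvector[OF eig] m x(2), folded S F_def]
  have lower: "?l ^ (n + 2) * (2 - F) \<le> clique_walk_sum E (n + 2)" by (rule tilted(1))
  have le: "?l ^ (n + 2) \<le> ?l ^ (n + 2) * (2 - F)"
    using F l by simp
  with lower show "?l ^ (n + 2) \<le> clique_walk_sum E (n + 2)" by linarith
  assume eq: "?l ^ (n + 2) = clique_walk_sum E (n + 2)"
  then have T: "clique_walk_sum E (n + 2) = ?l ^ (n + 2) * (2 - F)"
    using lower le by linarith
  then have "F = 1" using eq l by simp
  have edge: "0 < x u \<and> ?l * x u * x v = turan_factor E u v \<and> (odd n \<longrightarrow> x u = x v)" if "{u, v} \<in> E" for u v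
    using tilted(2)[OF _ T _ walk_matrix_edge_pos[OF that]] that by (auto simp: adj_eq split: if_splits)
  show "\<exists>x. (\<forall>u. (\<Sum>v\<in>UNIV. adj E u v * x v) = ?l * x u) \<and>
      (\<forall>u v. {u, v} \<in> E \<longrightarrow> 0 < x u \<and> ?l * x u * x v = turan_factor E u v \<and> (odd n \<longrightarrow> x u = x v)) \<and>
      (\<Sum>v\<in>UNIV. (x v)\<^sup>2) = 1 \<and> quad_form UNIV (clique_weight UNIV E) (\<lambda>v. (x v)\<^sup>2) = 1"
    using eig edge x(2) F(1) \<open>F = 1\<close> by (intro exI[of _ x]) auto
qed

text \<open>
  The Perron vector is positive exactly on the nonisolated vertices, so they are the support of a
  Motzkin--Straus maximizer and span a complete multipartite graph. Then all edges have the same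
  local clique number, so \<open>x u * x v\<close> is the same for all edges. In the presence of triangles this makes \<open>x\<close>
  constant along edges; for odd \<open>n\<close> sharpness of the entropy bound does. With \<open>x\<close> constant along edges
  the eigenvalue equation reads \<open>degree = \<lambda>\<close>.
\<close>

lemma extremal_graph_structure:
  fixes E :: "'n::finite set set"
  assumes G: "simple_graph UNIV E" and ne: "E \<noteq> {}"
    and eq: "graph_index E ^ (n + 2) = clique_walk_sum E (n + 2)"
  defines "W \<equiv> UNIV - isolated_vertices UNIV E" and "\<omega> \<equiv> clique_number UNIV E"
  shows "2 \<le> \<omega>" "complete_partite \<omega> W E" "odd n \<or> 3 \<le> \<omega> \<Longrightarrow> regular_graph W E"
proof -
  let ?l = "graph_index E"
  obtain x where eig: "\<And>u. (\<Sum>v\<in>UNIV. adj E u v * x v) = ?l * x u"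
    and edge: "\<And>u v. {u, v} \<in> E \<Longrightarrow> 0 < x u \<and> ?l * x u * x v = turan_factor E u v \<and> (odd n \<longrightarrow> x u = x v)"
    and x1: "(\<Sum>v\<in>UNIV. (x v)\<^sup>2) = 1" and ext: "quad_form UNIV (clique_weight UNIV E) (\<lambda>v. (x v)\<^sup>2) = 1"
    using index_pow_le_clique_walk_sum(2)[OF G ne eq] by blast
  have W: "v \<in> W \<longleftrightarrow> (\<exists>u. {u, v} \<in> E)" for v unfolding W_def by (rule nonisolated_iff[OF G])
  have pos: "0 < x v" if "v \<in> W" for v using that edge unfolding W by (metis insert_commute)
  obtain P where P: "partition_on W P" "E = multipartite_edges P"
  proof (rule complete_multipartite_if_nonadjacency_transitive[OF G])
    show "u \<in> W \<and> v \<in> W" if "{u, v} \<in> E" for u v using that by (auto simp: W) (metis insert_commute)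
    show "{u, w} \<notin> E" if "u \<in> W" "v \<in> W" "w \<in> W" "{u, v} \<notin> E" "{v, w} \<notin> E" for u v w
      by (rule nonadjacency_transitive_if_extremal[OF G _ x1 ext]) (use that pos in \<open>auto simp: less_imp_neq[symmetric]\<close>)
  qed
  obtain a b where ab: "{a, b} \<in> E" "a \<noteq> b"
    using ne simple_graph_edgeE[OF G] by (metis ex_in_conv)
  have \<omega>: "\<omega> = card P"
    unfolding \<omega>_def P(2) using ab P(2) by (intro multipartite_edge_clique_number[OF P(1)]) auto
  show "complete_partite \<omega> W E" unfolding complete_partite_iff using P \<omega> by blast
  have "card {a, b} \<le> \<omega>"
    unfolding \<omega>_def clique_number_def using ab
    by (intro Max_ge) (auto intro!: image_eqI[of _ _ "{a, b}"] simp: clique_def insert_commute)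
  then show "2 \<le> \<omega>" using ab by simp
  have l: "0 < ?l" using graph_perron_vector[OF G ne] by metis
  have m: "turan_factor E u v = turan_factor E a b" if "{u, v} \<in> E" for u v
    unfolding turan_factor_def using that ab P(2) multipartite_edge_clique_number(1)[OF P(1), of UNIV] by simp
  assume n: "odd n \<or> 3 \<le> \<omega>"
  \<comment> \<open>If \<open>\<omega> \<ge> 3\<close>, the edge lies in a triangle \<open>uvw\<close>, and the products on \<open>uw\<close> and \<open>vw\<close> agree.\<close>
  have const: "x u = x v" if e: "{u, v} \<in> E" for u v
    using n
  proof
    assume "3 \<le> \<omega>"
    obtain K where K: "clique K E" "{u, v} \<subseteq> K" "card K = card P"
      using clique_transversal_through_edge[OF P(1), of u v] e P(2) by metis
    have "\<not> K \<subseteq> {u, v}" using K(3) \<open>3 \<le> \<omega>\<close> \<omega> card_mono[of "{u, v}" K] card_insert_le_m1[of 2 "{v}" u] by auto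
    then obtain w where "w \<in> K" "w \<noteq> u" "w \<noteq> v" by blast
    then have uw: "{u, w} \<in> E" "{v, w} \<in> E" using K by (auto simp: clique_def)
    then have "?l * x u * x w = ?l * x v * x w" using edge m by metis
    moreover have "0 < x w" using edge[of w u] uw by (simp add: insert_commute)
    ultimately show ?thesis using l by simp
  qed (use edge[OF e] in simp)
  have "real (degree E v) = ?l" if v: "v \<in> W" for v
  proof -
    have "?l * x v = (\<Sum>u\<in>UNIV. adj E v u * x v)"
      unfolding eig[symmetric] by (intro sum.cong) (auto simp: adj_eq const)
    also have "\<dots> = real (degree E v) * x v" by (simp add: degree_eq_sum[OF G] sum_distrib_right)
    finally show ?thesis using pos[OF v] by simp
  qed
  then have "\<forall>u\<in>W. \<forall>v\<in>W. degree E u = degree E v" by (metis of_nat_eq_iff)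
  then show "regular_graph W E" unfolding regular_graph_def by blast
qed

section \<open>Attaining equality\<close>

text \<open>
  Any eigenvalue \<open>c\<close> satisfies \<open>c \<le> \<lambda>\<close>, and \<open>\<lambda>^(n+2) \<le> c^(n+2)\<close> is the inequality already proved. So it is
  enough to exhibit some eigenvector for \<open>c\<close>, without knowing that \<open>c\<close> is the largest eigenvalue.
\<close>

lemma index_pow_eq_if_eigenvalue:
  assumes G: "simple_graph UNIV E" and ne: "E \<noteq> {}" and c: "0 \<le> c" "clique_walk_sum E (n + 2) = c ^ (n + 2)"
    and eig: "\<And>u. (\<Sum>v\<in>UNIV. adj E u v * y v) = c * y u" "y a \<noteq> 0"
  shows "graph_index E ^ (n + 2) = clique_walk_sum E (n + 2)"
proof (rule antisym)
  show "graph_index E ^ (n + 2) \<le> clique_walk_sum E (n + 2)" by (rule index_pow_le_clique_walk_sum(1)[OF G ne])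
  have "c \<le> graph_index E" by (rule eigenvalue_le_graph_index[OF eig])
  then show "clique_walk_sum E (n + 2) \<le> graph_index E ^ (n + 2)"
    unfolding c(2) using c(1) by (rule power_mono)
qed

text \<open>
  A vertex in the part \<open>A\<close> has degree \<open>|W| - |A|\<close>, so regularity of degree \<open>d\<close> gives all parts the size
  \<open>|W| - d\<close> and \<open>k * d = (k - 1) * |W|\<close>. As there are \<open>d^n\<close> walks from each vertex of \<open>W\<close>, the sum is
  \<open>(k - 1) / k * |W| * d^(n+1) = d^(n+2)\<close>, and the indicator of \<open>W\<close> is an eigenvector for \<open>d\<close>.
\<close>

lemma regular_multipartite_extremal:
  fixes E :: "'n::finite set set"
  assumes G: "simple_graph UNIV E" and ne: "E \<noteq> {}"
  defines "W \<equiv> UNIV - isolated_vertices UNIV E"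
  assumes part: "complete_partite k W E" and reg: "regular_graph W E"
  shows "graph_index E ^ (n + 2) = clique_walk_sum E (n + 2)"
proof -
  obtain P where P: "partition_on W P" "card P = k" "E = multipartite_edges P"
    using part by (auto simp: complete_partite_iff)
  obtain d where d: "\<And>v. v \<in> W \<Longrightarrow> degree E v = d" using reg by (auto simp: regular_graph_def)
  have W: "v \<in> W \<longleftrightarrow> (\<exists>u. {u, v} \<in> E)" for v unfolding W_def by (rule nonisolated_iff[OF G])
  obtain a b where ab: "{a, b} \<in> E" "a \<noteq> b"
    using ne simple_graph_edgeE[OF G] by (metis ex_in_conv)
  have aW: "b \<in> W" using ab W by blast
  have adjW: "v \<in> W" "u \<in> W" if "adj E u v \<noteq> 0" for u v
    using that W[of v] W[of u] by (auto simp: adj_eq insert_commute split: if_splits)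
  have deg: "(\<Sum>v\<in>UNIV. adj E u v) = (if u \<in> W then real d else 0)" for u
  proof (cases "u \<in> W")
    case False
    then have "adj E u v = 0" for v using adjW(2) by blast
    then show ?thesis using False by simp
  qed (use degree_eq_sum[OF G, of u] d in simp)
  have walks: "real (num_walks E (Suc j) v) = real d ^ j" if "v \<in> W" for j v
    using that
  proof (induction j arbitrary: v)
    case (Suc j)
    have "real (num_walks E (Suc (Suc j)) v) = (\<Sum>u\<in>UNIV. adj E v u * real d ^ j)"
      unfolding num_walks_Suc
    proof (intro sum.cong refl)
      fix u show "adj E v u * real (num_walks E (Suc j) u) = adj E v u * real d ^ j"
        using Suc.IH[of u] adjW(1)[of v u] by (cases "adj E v u = 0") auto
    qed
    then show ?case using deg[of v] Suc.prems by (simp flip: sum_distrib_right)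
  qed (simp add: num_walks_1)
  have size: "real k * real d = (real k - 1) * real (card W)"
  proof -
    have "real (card A) = real (card W) - real d" if A: "A \<in> P" for A
    proof -
      obtain v where v: "v \<in> A" using A partition_onD3[OF P(1)] by (metis ex_in_conv)
      have sub: "A \<subseteq> W" using A partition_onD1[OF P(1)] by blast
      have "d = card (W - A)"
        using d[of v] v sub degree_eq_card_neighbours[OF G, of v] neighbours_in_multipartite[OF P(1) A v] P(3) by auto
      also have "\<dots> = card W - card A" using sub by (simp add: card_Diff_subset)
      finally show ?thesis using card_mono[of W A] sub by simp
    qed
    then have "real (\<Sum>A\<in>P. card A) = real k * (real (card W) - real d)"
      using P(2) by simp
    moreover have "card W = (\<Sum>A\<in>P. card A)"
      using P(1) product_partition[of W P] by simp
    ultimately show ?thesis by (simp add: algebra_simps)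
  qed
  have k2: "0 < k" using P(3) P(2) ab by (auto simp: multipartite_edges_iff card_gt_0_iff)
  have m: "turan_factor E u v = (real k - 1) / real k" if "{u, v} \<in> E" for u v
    unfolding turan_factor_def using that P multipartite_edge_clique_number(1)[OF P(1), of UNIV] by simp
  have "clique_walk_sum E (n + 2) = (\<Sum>u\<in>UNIV. \<Sum>v\<in>UNIV. adj E u v * ((real k - 1) / real k * real d ^ n))"
    unfolding clique_walk_sum_eq[OF G]
    by (intro sum.cong refl) (auto simp: adj_eq m walks[OF iffD2[OF W, OF exI]])
  also have "\<dots> = (\<Sum>u\<in>UNIV. (if u \<in> W then real d else 0) * ((real k - 1) / real k * real d ^ n))"
    by (simp only: sum_distrib_right[symmetric] deg)
  also have "\<dots> = real (card W) * real d * ((real k - 1) / real k * real d ^ n)"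
    by (simp only: sum_distrib_right[symmetric]) (simp add: sum.If_cases)
  also have "\<dots> = ((real k - 1) * real (card W)) * real d ^ (n + 1) / real k" by simp
  also have "\<dots> = real d ^ (n + 2)" using k2 by (simp flip: size)
  finally have S: "clique_walk_sum E (n + 2) = real d ^ (n + 2)" .
  show ?thesis
  proof (rule index_pow_eq_if_eigenvalue[OF G ne _ S])
    show "(\<Sum>v\<in>UNIV. adj E u v * of_bool (v \<in> W)) = real d * of_bool (u \<in> W)" for u
    proof -
      have "(\<Sum>v\<in>UNIV. adj E u v * of_bool (v \<in> W)) = (\<Sum>v\<in>UNIV. adj E u v)"
        by (intro sum.cong refl) (use adjW in \<open>auto simp: of_bool_def\<close>)
      then show ?thesis by (simp add: deg)
    qed
    show "of_bool (b \<in> W) \<noteq> (0 :: real)" using aW by simp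
  qed simp
qed

text \<open>
  With parts of sizes \<open>a\<close> and \<open>b\<close>, two consecutive steps of a walk can be chosen in \<open>a * b\<close> ways from either
  side, so for even \<open>n\<close> the number of walks does not depend on the starting vertex. The eigenvalue is
  \<open>sqrt (a * b)\<close>, with entries \<open>sqrt b\<close> on the part of size \<open>a\<close> and \<open>sqrt a\<close> on the part of size \<open>b\<close>.
\<close>

lemma bipartite_even_extremal:
  fixes E :: "'n::finite set set"
  assumes G: "simple_graph UNIV E" and ne: "E \<noteq> {}"
    and part: "complete_partite 2 (UNIV - isolated_vertices UNIV E) E" and n: "even n"
  shows "graph_index E ^ (n + 2) = clique_walk_sum E (n + 2)"
proof -
  define W where "W = UNIV - isolated_vertices UNIV E"
  obtain P where P: "partition_on W P" "card P = 2" "E = multipartite_edges P"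
    using part by (auto simp: complete_partite_iff W_def)
  obtain A B where AB: "P = {A, B}" "A \<noteq> B" using P(2) by (auto simp: card_2_iff)
  have W: "W = A \<union> B" using partition_onD1[OF P(1)] AB by auto
  have disj: "A \<inter> B = {}" using partition_onD2[OF P(1)] AB by (auto simp: disjnt_def pairwise_def)
  have "A \<noteq> {}" "B \<noteq> {}" using partition_onD3[OF P(1)] AB by auto
  then obtain z where z: "z \<in> A" by blast
  define a b where "a = real (card A)" and "b = real (card B)"
  have ab0: "0 \<le> a" "0 \<le> b" by (simp_all add: a_def b_def)
  have adjAB: "adj E u v = (if u \<in> A \<and> v \<in> B \<or> u \<in> B \<and> v \<in> A then 1 else 0)" for u v
    using AB by (auto simp: adj_eq P(3) multipartite_edges_iff)
  have sumA: "(\<Sum>v\<in>UNIV. adj E u v * f v) = (if u \<in> A then sum f B else if u \<in> B then sum f A else 0)"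
    for f u
    using disj by (auto simp: adjAB if_distrib[of "\<lambda>a. a * _"] sum.If_cases cong: if_cong)
  have walks: "real (num_walks E (Suc (2 * j)) v) = (a * b) ^ j" if "v \<in> W" for j v
    using that
  proof (induction j arbitrary: v)
    case (Suc j)
    have *: "real (num_walks E (Suc (2 * Suc j)) v) = (\<Sum>u\<in>UNIV. adj E v u * (\<Sum>w\<in>UNIV. adj E u w * real (num_walks E (Suc (2 * j)) w)))"
      by (simp add: num_walks_Suc)
    have "sum (\<lambda>w. real (num_walks E (Suc (2 * j)) w)) A = a * (a * b) ^ j"
         "sum (\<lambda>w. real (num_walks E (Suc (2 * j)) w)) B = b * (a * b) ^ j"
      using Suc.IH W by (simp_all add: a_def b_def)
    moreover have "sum (\<lambda>u. if u \<in> A then s else if u \<in> B then t else 0) A = a * s"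
      "sum (\<lambda>u. if u \<in> A then s else if u \<in> B then t else 0) B = b * t" for s t :: real
    proof -
      show "sum (\<lambda>u. if u \<in> A then s else if u \<in> B then t else 0) A = a * s"
        by (simp add: a_def)
      have "sum (\<lambda>u. if u \<in> A then s else if u \<in> B then t else 0) B = sum (\<lambda>u. t) B"
        by (rule sum.cong) (use disj in auto)
      then show "sum (\<lambda>u. if u \<in> A then s else if u \<in> B then t else 0) B = b * t"
        by (simp add: b_def)
    qed
    ultimately show ?case using Suc.prems W
      unfolding * sumA by (auto simp: mult_ac)
  qed (simp add: num_walks_1)
  obtain j where j: "n = 2 * j" using n by blast
  have m: "turan_factor E u v = 1 / 2" if "{u, v} \<in> E" for u v
    unfolding turan_factor_def using that P multipartite_edge_clique_number(1)[OF P(1), of UNIV] by simp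
  have "clique_walk_sum E (n + 2) = (\<Sum>u\<in>UNIV. \<Sum>v\<in>UNIV. adj E u v * (1 / 2 * (a * b) ^ j))"
    unfolding clique_walk_sum_eq[OF G]
  proof (intro sum.cong refl)
    fix u v
    show "adj E u v * turan_factor E u v * real (num_walks E (Suc n) v) = adj E u v * (1 / 2 * (a * b) ^ j)"
    proof (cases "{u, v} \<in> E")
      case True
      then have "v \<in> W" using adjAB[of u v] W by (auto simp: adj_eq split: if_splits)
      then show ?thesis using walks[of v j] m[OF True] by (simp add: j)
    qed (simp add: adj_eq)
  qed
  also have "\<dots> = (a * b) ^ (j + 1)"
  proof -
    have "B \<inter> - A = B" "- A \<inter> B = B" using disj by blast+
    then show ?thesis unfolding sumA by (simp add: sum.If_cases flip: a_def b_def)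
  qed
  also have "\<dots> = sqrt (a * b) ^ (n + 2)"
  proof -
    have "sqrt (a * b) ^ (n + 2) = ((sqrt (a * b))\<^sup>2) ^ (j + 1)"
      unfolding power_mult[symmetric] by (simp add: j)
    then show ?thesis using ab0 by simp
  qed
  finally have S: "clique_walk_sum E (n + 2) = sqrt (a * b) ^ (n + 2)" .
  show ?thesis
  proof (rule index_pow_eq_if_eigenvalue[OF G ne _ S])
    define y where "y = (\<lambda>v. if v \<in> A then sqrt b else if v \<in> B then sqrt a else 0)"
    have "sum y B = sum (\<lambda>v. sqrt a) B" by (rule sum.cong) (use disj in \<open>auto simp: y_def\<close>)
    then have "sum y A = a * sqrt b" "sum y B = b * sqrt a"
      by (simp_all add: y_def a_def b_def)
    then show "(\<Sum>v\<in>UNIV. adj E u v * y v) = sqrt (a * b) * y u" for u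
      using ab0 disj unfolding sumA by (auto simp: y_def real_sqrt_mult)
    show "y z \<noteq> 0" using z \<open>B \<noteq> {}\<close> by (simp add: y_def b_def)
  qed (use ab0 in simp)
qed

theorem theorem1p3:
  fixes E :: "'n::finite set set" and r :: nat
  defines "\<omega> \<equiv> clique_number UNIV E"
    and "W \<equiv> UNIV - isolated_vertices UNIV E"
    and "S \<equiv> (\<Sum>e\<in>E. (real (edge_clique_number UNIV E e) - 1) / real (edge_clique_number UNIV E e)
                    * (\<Sum>v\<in>e. real (num_walks E (r - 1) v)))"
  assumes "simple_graph UNIV E" and "E \<noteq> {}" and "r \<ge> 2"
  shows "graph_index E ^ r \<le> S \<and>
         (graph_index E ^ r = S \<longleftrightarrow>
            (\<omega> \<ge> 3 \<and> complete_partite \<omega> W E \<and> regular_graph W E) \<or>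
            (\<omega> = 2 \<and> complete_partite 2 W E \<and> (odd r \<longrightarrow> regular_graph W E)))"
proof -
  note G = \<open>simple_graph UNIV E\<close> and ne = \<open>E \<noteq> {}\<close>
  obtain n where r: "r = n + 2" using \<open>r \<ge> 2\<close> by (metis le_add_diff_inverse2)
  have S: "S = clique_walk_sum E (n + 2)" by (simp add: S_def clique_walk_sum_def r)
  show ?thesis
    unfolding r S
  proof (intro conjI iffI)
    show "graph_index E ^ (n + 2) \<le> clique_walk_sum E (n + 2)"
      by (rule index_pow_le_clique_walk_sum(1)[OF G ne])
  next
    assume "graph_index E ^ (n + 2) = clique_walk_sum E (n + 2)"
    note ext = extremal_graph_structure[OF G ne this, folded \<omega>_def W_def]
    show "\<omega> \<ge> 3 \<and> complete_partite \<omega> W E \<and> regular_graph W E \<or>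
        \<omega> = 2 \<and> complete_partite 2 W E \<and> (odd (n + 2) \<longrightarrow> regular_graph W E)"
    proof (cases "\<omega> = 2")
      case True
      then show ?thesis using ext(2,3) by simp
    next
      case False
      then have "3 \<le> \<omega>" using ext(1) by simp
      then show ?thesis using ext(2,3) by simp
    qed
  next
    assume "\<omega> \<ge> 3 \<and> complete_partite \<omega> W E \<and> regular_graph W E \<or>
        \<omega> = 2 \<and> complete_partite 2 W E \<and> (odd (n + 2) \<longrightarrow> regular_graph W E)"
    then consider k where "complete_partite k W E" "regular_graph W E"
      | "complete_partite 2 W E" "even n" by auto
    then show "graph_index E ^ (n + 2) = clique_walk_sum E (n + 2)"
      using regular_multipartite_extremal[OF G ne] bipartite_even_extremal[OF G ne]
      unfolding W_def by cases blast+
  qed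
qed

end
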